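(* Let $A$ be a ring and let $I \subseteq A$ be an ideal. Then the ideal $I^{\boxed{\#}}$ is the root closure of $I$ in $A$; that is, $I^{\boxed{\#}}$ is the smallest ideal of $A$ which contains $I$ and is root closed in $A$.
   Context: All rings are commutative with identity. An ideal $J$ of a ring $A$ is root closed in $A$ if whenever $x^n \in J^n$ for some $x \in A$ and some integer $n \ge 1$, then $x \in J$. The root closure of an ideal $I$ in $A$ is the smallest ideal of $A$ which contains $I$ and is root closed in $A$. For an ideal $I$ of a ring $A$, let $I^{\#}$ be the ideal of $A$ generated by $\{x \in A \mid x^n \in I^n \text{ for some } n \ge 1\}$; let $I^{\#_1} = I^{\#}$ and, for $\ell > 1$, $I^{\#_\ell} = \langle x \in A \mid x^n \in (I^{\#_{\ell-1}})^n \text{ for some } n \ge 1\rangle$; let $I^{\boxed{\#}} = \bigcup_{\ell \ge 1} I^{\#_\ell}$ (an increasing union of ideals). *)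

theory Defs
  imports "HOL-Algebra.Ideal_Product"
begin

text \<open>
  The power of an ideal is taken in the multiplicative monoid of \<^const>\<open>ideals_set\<close>,
  whose product is \<^const>\<open>ideal_prod\<close> and whose unit is the whole ring.
\<close>

definition root_closed :: "('a, 'b) ring_scheme \<Rightarrow> 'a set \<Rightarrow> bool"
  where "root_closed A J \<longleftrightarrow>
    (\<forall>x \<in> carrier A. \<forall>n::nat. n \<ge> 1 \<longrightarrow>
       x [^]\<^bsub>A\<^esub> n \<in> J [^]\<^bsub>ideals_set A\<^esub> n \<longrightarrow> x \<in> J)"

text \<open>
  The root closure is rendered as a relation rather than by a description operator, so that
  asserting that an ideal is the root closure of another one includes the assertion that
  a smallest root closed ideal exists.
\<close>

definition is_root_closure :: "('a, 'b) ring_scheme \<Rightarrow> 'a set \<Rightarrow> 'a set \<Rightarrow> bool"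
  where "is_root_closure A I K \<longleftrightarrow>
    ideal K A \<and> I \<subseteq> K \<and> root_closed A K \<and>
    (\<forall>J. ideal J A \<and> I \<subseteq> J \<and> root_closed A J \<longrightarrow> K \<subseteq> J)"

lemma is_root_closure_unique:
  "is_root_closure A I K \<Longrightarrow> is_root_closure A I L \<Longrightarrow> K = L"
  unfolding is_root_closure_def by blast

definition sharp :: "('a, 'b) ring_scheme \<Rightarrow> 'a set \<Rightarrow> 'a set"
  where "sharp A I =
    Idl\<^bsub>A\<^esub> {x \<in> carrier A. \<exists>n::nat. n \<ge> 1 \<and> x [^]\<^bsub>A\<^esub> n \<in> I [^]\<^bsub>ideals_set A\<^esub> n}"

definition sharp_iter :: "('a, 'b) ring_scheme \<Rightarrow> nat \<Rightarrow> 'a set \<Rightarrow> 'a set"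
  where "sharp_iter A l I = (sharp A ^^ l) I"

lemma sharp_iter_1: "sharp_iter A 1 I = sharp A I"
  by (simp add: sharp_iter_def)

lemma sharp_iter_step:
  assumes "l > 1"
  shows "sharp_iter A l I =
    Idl\<^bsub>A\<^esub> {x \<in> carrier A. \<exists>n::nat. n \<ge> 1 \<and>
      x [^]\<^bsub>A\<^esub> n \<in> sharp_iter A (l - 1) I [^]\<^bsub>ideals_set A\<^esub> n}"
  using assms by (cases l) (simp_all add: sharp_iter_def sharp_def)

definition box_sharp :: "('a, 'b) ring_scheme \<Rightarrow> 'a set \<Rightarrow> 'a set"
  where "box_sharp A I = (\<Union>l\<in>{1..}. sharp_iter A l I)"

end

theory Submission
  imports Defs "HOL-Algebra.Ring_Divisibility"
begin

text \<open>
  That \<open>K =\<close> \<^term>\<open>box_sharp A I\<close> is root closed is a finiteness argument. Membership in a power of an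
  ideal is witnessed by finitely many elements of the ideal, so if the ideal is the union of an
  increasing sequence, then all of the witnesses lie in one term of the sequence
  (\<open>ideal_pow_UN_incseq\<close>). A relation \<open>x\<^sup>n \<in> K\<^sup>n\<close> therefore already holds at
  some finite stage \<open>l\<close>, and then \<open>x\<close> is one of the generators of stage \<open>l + 1\<close>.

  That it is the smallest such ideal follows by induction on the stage: powers of ideals are
  monotone, so a root closed ideal containing \<open>J\<close> contains every generator of
  \<^term>\<open>sharp A J\<close> (\<open>sharp_subset_root_closed\<close>).
\<close>

lemma ideals_set_simps [simp]:
  "\<one>\<^bsub>ideals_set R\<^esub> = carrier R"
  "I \<otimes>\<^bsub>ideals_set R\<^esub> J = ideal_prod R I J"
  by (simp_all add: ideals_set_def)

lemma ideal_prod_mono: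
  assumes "I \<subseteq> I'" "J \<subseteq> J'"
  shows "ideal_prod R I J \<subseteq> ideal_prod R I' J'"
proof
  fix s assume "s \<in> ideal_prod R I J"
  then show "s \<in> ideal_prod R I' J'"
    using assms by induction (auto intro: ideal_prod.intros)
qed

lemma ideal_pow_mono:
  assumes "I \<subseteq> J"
  shows "I [^]\<^bsub>ideals_set R\<^esub> (n::nat) \<subseteq> J [^]\<^bsub>ideals_set R\<^esub> n"
  using assms by (induction n) (simp_all add: ideal_prod_mono)

text \<open>
  An element of a product of two increasing unions is a finite sum of products of two elements,
  and the maximum of the finitely many stages involved serves for all of them.
\<close>
lemma ideal_prod_UN_incseq:
  fixes F G :: "nat \<Rightarrow> 'a set"
  assumes "incseq F" "incseq G"
  shows "ideal_prod R (\<Union>l. F l) (\<Union>l. G l) = (\<Union>l. ideal_prod R (F l) (G l))"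
proof
  have mono: "ideal_prod R (F k) (G k) \<subseteq> ideal_prod R (F l) (G l)" if "k \<le> l" for k l
    using that assms by (intro ideal_prod_mono) (simp_all add: incseqD)
  show "ideal_prod R (\<Union>l. F l) (\<Union>l. G l) \<subseteq> (\<Union>l. ideal_prod R (F l) (G l))"
  proof
    fix s assume "s \<in> ideal_prod R (\<Union>l. F l) (\<Union>l. G l)"
    then show "s \<in> (\<Union>l. ideal_prod R (F l) (G l))"
    proof induction
      case (prod i j)
      then obtain k l where "i \<in> F k" "j \<in> G l" by blast
      then have "i \<in> F (max k l)" "j \<in> G (max k l)"
        using incseqD[OF assms(1), of k "max k l"] incseqD[OF assms(2), of l "max k l"] by auto
      then show ?case by (blast intro: ideal_prod.prod)
    next
      case (sum s t)
      then obtain k l where "s \<in> ideal_prod R (F k) (G k)" "t \<in> ideal_prod R (F l) (G l)"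
        by blast
      then have "s \<in> ideal_prod R (F (max k l)) (G (max k l))"
          "t \<in> ideal_prod R (F (max k l)) (G (max k l))"
        using mono[of k "max k l"] mono[of l "max k l"] by auto
      then show ?case by (blast intro: ideal_prod.sum)
    qed
  qed
  show "(\<Union>l. ideal_prod R (F l) (G l)) \<subseteq> ideal_prod R (\<Union>l. F l) (\<Union>l. G l)"
    by (intro UN_least ideal_prod_mono) auto
qed

lemma ideal_pow_UN_incseq:
  fixes F :: "nat \<Rightarrow> 'a set"
  assumes "incseq F"
  shows "(\<Union>l. F l) [^]\<^bsub>ideals_set R\<^esub> (n::nat) = (\<Union>l. F l [^]\<^bsub>ideals_set R\<^esub> n)"
proof (induction n)
  case (Suc n)
  have "incseq (\<lambda>l. F l [^]\<^bsub>ideals_set R\<^esub> n)"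
    using assms by (simp add: incseq_def ideal_pow_mono)
  then show ?case
    using Suc ideal_prod_UN_incseq[OF _ assms] by simp
qed simp

lemma (in ring) ideal_UN_incseq:
  fixes F :: "nat \<Rightarrow> 'a set"
  assumes "incseq F" "\<And>l. ideal (F l) R"
  shows "ideal (\<Union>l. F l) R"
proof -
  have "F k \<subseteq> F l \<or> F l \<subseteq> F k" for k l
    using incseqD[OF assms(1)] nat_le_linear[of k l] by fast
  then have "subset.chain {I. ideal I R} (range F)"
    using assms(2) by (simp add: subset_chain_def image_subset_iff)
  then show ?thesis
    using chain_Union_is_ideal[of "range F"] by simp
qed

lemma (in ring) sharp_is_ideal: "ideal (sharp R I) R"
  unfolding sharp_def by (rule genideal_ideal) auto

lemma (in ring) mem_sharpI:
  assumes "x \<in> carrier R" "n \<ge> 1" "x [^] n \<in> I [^]\<^bsub>ideals_set R\<^esub> (n::nat)"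
  shows "x \<in> sharp R I"
  unfolding sharp_def by (rule subsetD[OF genideal_self]) (use assms in auto)

lemma (in ring) subset_sharp:
  assumes "I \<subseteq> carrier R"
  shows "I \<subseteq> sharp R I"
proof
  fix x assume x: "x \<in> I"
  then have "\<one> \<otimes> x \<in> ideal_prod R (carrier R) I"
    by (intro ideal_prod.prod) auto
  then show "x \<in> sharp R I"
    using x assms by (intro mem_sharpI[of x 1]) auto
qed

lemma (in ring) sharp_subset_root_closed:
  assumes "ideal K R" "root_closed R K" "J \<subseteq> K"
  shows "sharp R J \<subseteq> K"
  unfolding sharp_def
proof (rule genideal_minimal[OF assms(1)])
  show "{x \<in> carrier R. \<exists>n::nat. n \<ge> 1 \<and> x [^] n \<in> J [^]\<^bsub>ideals_set R\<^esub> n} \<subseteq> K"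
    using assms(2) ideal_pow_mono[OF assms(3)] unfolding root_closed_def by blast
qed

lemma sharp_iter_0 [simp]: "sharp_iter A 0 I = I"
  by (simp add: sharp_iter_def)

lemma sharp_iter_Suc [simp]: "sharp_iter A (Suc l) I = sharp A (sharp_iter A l I)"
  by (simp add: sharp_iter_def)

lemma (in ring) sharp_iter_is_ideal:
  assumes "ideal I R"
  shows "ideal (sharp_iter R l I) R"
  using assms by (cases l) (auto intro: sharp_is_ideal)

lemma (in ring) incseq_sharp_iter:
  assumes "ideal I R"
  shows "incseq (\<lambda>l. sharp_iter R l I)"
proof (rule incseq_SucI)
  fix l
  show "sharp_iter R l I \<subseteq> sharp_iter R (Suc l) I"
    using subset_sharp[of "sharp_iter R l I"] sharp_iter_is_ideal[OF assms, of l]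
    by (auto dest: ideal.Icarr)
qed

text \<open>
  Starting the union at stage \<open>0\<close>, which is \<^term>\<open>I\<close> itself, does not change it. In this form the
  union runs over all natural numbers and visibly contains \<^term>\<open>I\<close>.
\<close>
lemma (in ring) box_sharp_eq_UN:
  assumes "ideal I R"
  shows "box_sharp R I = (\<Union>l. sharp_iter R l I)"
proof -
  have "sharp_iter R l I \<subseteq> sharp_iter R (Suc l) I" for l
    using incseq_sharp_iter[OF assms] by (rule incseq_SucD)
  then show ?thesis
    unfolding box_sharp_def by fastforce
qed

theorem proposition2p7:
  fixes A :: "('a, 'b) ring_scheme" and I :: "'a set"
  assumes "cring A"
    and "ideal I A"
  shows "is_root_closure A I (box_sharp A I)"
proof -
  interpret cring A by fact
  define F where "F l = sharp_iter A l I" for l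
  have box: "box_sharp A I = (\<Union>l. F l)"
    using box_sharp_eq_UN[OF assms(2)] by (simp add: F_def)
  have inc: "incseq F"
    using incseq_sharp_iter[OF assms(2)] by (simp add: F_def[abs_def])
  have "ideal (\<Union>l. F l) A"
    using inc by (rule ideal_UN_incseq) (simp add: F_def sharp_iter_is_ideal[OF assms(2)])
  moreover have "I \<subseteq> (\<Union>l. F l)"
    using UN_upper[of 0 UNIV F] by (simp add: F_def)
  moreover have "root_closed A (\<Union>l. F l)"
    unfolding root_closed_def
  proof (intro ballI allI impI)
    fix x and n :: nat
    assume x: "x \<in> carrier A" "1 \<le> n" "x [^]\<^bsub>A\<^esub> n \<in> (\<Union>l. F l) [^]\<^bsub>ideals_set A\<^esub> n"
    then obtain l where "x [^]\<^bsub>A\<^esub> n \<in> F l [^]\<^bsub>ideals_set A\<^esub> n"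
      unfolding ideal_pow_UN_incseq[OF inc] by blast
    then have "x \<in> F (Suc l)"
      using x mem_sharpI by (simp add: F_def)
    then show "x \<in> (\<Union>l. F l)" by blast
  qed
  moreover have "(\<Union>l. F l) \<subseteq> J" if J: "ideal J A" "I \<subseteq> J" "root_closed A J" for J
  proof (rule UN_least)
    fix l
    show "F l \<subseteq> J"
      by (induction l) (use J sharp_subset_root_closed in \<open>simp_all add: F_def\<close>)
  qed
  ultimately show ?thesis
    unfolding is_root_closure_def box by blast
qed

end
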